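(* Let $\varphi:D\to\mathbb{R}$ be a continuous function with graph $\Gamma\varphi=\{(x,y,\varphi(x,y)):(x,y)\in D\}\subset\mathbb{R}^3$. Then \[ 1+\varliminf_{n\to\infty}\frac{\log\big(O_n(\varphi,D)+N^n\big)}{n\log N}\;\le\;\underline{\dim}_B\,\Gamma\varphi\;\le\;\overline{\dim}_B\,\Gamma\varphi\;\le\;1+\varlimsup_{n\to\infty}\frac{\log\big(O_n(\varphi,D)+N^n\big)}{n\log N}. \]
   Context: Grid. Let $N\ge 2$ be an integer, and let $x_0<x_1<\cdots<x_N$ and $y_0<y_1<\cdots<y_N$ be real numbers with $x_i-x_{i-1}=(x_N-x_0)/N$ and $y_i-y_{i-1}=(y_N-y_0)/N$ for $1\le i\le N$, and $x_N-x_0=y_N-y_0$. Put $I=[x_0,x_N]$, $J=[y_0,y_N]$, $D=I\times J$, $I_i=[x_{i-1},x_i]$, $J_j=[y_{j-1},y_j]$. For $1\le i\le N$ let $u_i:I\to I_i$ be the affine map with $u_i(x_0)=x_{i-1}$, $u_i(x_N)=x_i$ if $i$ is odd, and $u_i(x_0)=x_i$, $u_i(x_N)=x_{i-1}$ if $i$ is even; let $v_j:J\to J_j$ be the affine map with $v_j(y_0)=y_{j-1}$, $v_j(y_N)=y_j$ if $j$ is odd, and $v_j(y_0)=y_j$, $v_j(y_N)=y_{j-1}$ if $j$ is even. Let $\Sigma=\{1,\dots,N\}\times\{1,\dots,N\}$. For $w=(i,j)\in\Sigma$ let $D_w=I_i\times J_j$ and $L_w:D\to D_w$, $L_w(x,y)=(u_i(x),v_j(y))$.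 Words. For $n\ge1$, $\Sigma^n$ is the set of words $\mathbf w=w_1\cdots w_n$ with $w_1,\dots,w_n\in\Sigma$. For $\mathbf w=w_1\cdots w_n\in\Sigma^n$ put $L_{\mathbf w}=L_{w_1}\circ\cdots\circ L_{w_n}$ and $D_{\mathbf w}=L_{\mathbf w}(D)$. Oscillation sums. For $E\subset D$, $O(\varphi,E)=\sup\{\varphi(\mathbf x')-\varphi(\mathbf x''):\mathbf x',\mathbf x''\in E\}$, and $O_n(\varphi,D)=\sum_{\mathbf w\in\Sigma^n}O(\varphi,D_{\mathbf w})$ for $n\ge 1$. Box dimension. For $\varepsilon>0$, an $\varepsilon$-coordinate cube in $\mathbb{R}^d$ is a set $\prod_{i=1}^d[n_i\varepsilon,(n_i+1)\varepsilon]$ with $n_1,\dots,n_d\in\mathbb{Z}$. For bounded $E\subset\mathbb{R}^d$, let $\mathcal N_E(\varepsilon)$ be the number of $\varepsilon$-coordinate cubes intersecting $E$. Then $\overline{\dim}_B E=\varlimsup_{\varepsilon\to0}\frac{\log\mathcal N_E(\varepsilon)}{\log(1/\varepsilon)}$ and $\underline{\dim}_B E=\varliminf_{\varepsilon\to0}\frac{\log\mathcal N_E(\varepsilon)}{\log(1/\varepsilon)}$. *)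

theory Defs
  imports "HOL-Analysis.Analysis"
begin

text \<open>
  A grid is given by \<open>N\<close> and two sequences \<open>x, y :: nat \<Rightarrow> real\<close>, of which only the entries
  with index at most \<open>N\<close> are used. Words over \<open>\<Sigma>\<close> are lists.
\<close>

definition grid_dom :: "nat \<Rightarrow> (nat \<Rightarrow> real) \<Rightarrow> (nat \<Rightarrow> real) \<Rightarrow> (real \<times> real) set" where
  "grid_dom N x y = {x 0..x N} \<times> {y 0..y N}"

text \<open>The affine map sending \<open>a\<close> to \<open>c\<close> and \<open>b\<close> to \<open>d\<close> (for \<open>a \<noteq> b\<close>).\<close>

definition affine_interp :: "real \<Rightarrow> real \<Rightarrow> real \<Rightarrow> real \<Rightarrow> real \<Rightarrow> real" where
  "affine_interp a b c d t = c + (d - c) * ((t - a) / (b - a))"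

lemma affine_interp_endpoints:
  "affine_interp a b c d a = c"
  "a \<noteq> b \<Longrightarrow> affine_interp a b c d b = d"
  by (simp_all add: affine_interp_def)

text \<open>\<open>cell_map N x i\<close> is \<open>u\<^sub>i\<close>, and \<open>cell_map N y j\<close> is \<open>v\<^sub>j\<close>.\<close>

definition cell_map :: "nat \<Rightarrow> (nat \<Rightarrow> real) \<Rightarrow> nat \<Rightarrow> real \<Rightarrow> real" where
  "cell_map N x i =
     (if odd i then affine_interp (x 0) (x N) (x (i - 1)) (x i)
      else affine_interp (x 0) (x N) (x i) (x (i - 1)))"

definition grid_alphabet :: "nat \<Rightarrow> (nat \<times> nat) set" where
  "grid_alphabet N = {1..N} \<times> {1..N}"

definition grid_words :: "nat \<Rightarrow> nat \<Rightarrow> (nat \<times> nat) list set" where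
  "grid_words N n = {w. length w = n \<and> set w \<subseteq> grid_alphabet N}"

definition letter_map ::
    "nat \<Rightarrow> (nat \<Rightarrow> real) \<Rightarrow> (nat \<Rightarrow> real) \<Rightarrow> nat \<times> nat \<Rightarrow> real \<times> real \<Rightarrow> real \<times> real" where
  "letter_map N x y w p = (cell_map N x (fst w) (fst p), cell_map N y (snd w) (snd p))"

definition word_map ::
    "nat \<Rightarrow> (nat \<Rightarrow> real) \<Rightarrow> (nat \<Rightarrow> real) \<Rightarrow> (nat \<times> nat) list \<Rightarrow> real \<times> real \<Rightarrow> real \<times> real" where
  "word_map N x y w = foldr (\<circ>) (map (letter_map N x y) w) id"

definition word_cell ::
    "nat \<Rightarrow> (nat \<Rightarrow> real) \<Rightarrow> (nat \<Rightarrow> real) \<Rightarrow> (nat \<times> nat) list \<Rightarrow> (real \<times> real) set" where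
  "word_cell N x y w = word_map N x y w ` grid_dom N x y"

text \<open>
  The supremum is taken in \<^typ>\<open>real\<close>, so it is meaningful only when \<open>E\<close> is nonempty and
  \<open>\<phi>\<close> is bounded on \<open>E\<close>, as it is for a continuous \<open>\<phi>\<close> on a cell of the grid.
\<close>

definition oscillation :: "('a \<Rightarrow> real) \<Rightarrow> 'a set \<Rightarrow> real" where
  "oscillation \<phi> E = Sup {\<phi> p - \<phi> q | p q. p \<in> E \<and> q \<in> E}"

definition osc_sum ::
    "nat \<Rightarrow> (nat \<Rightarrow> real) \<Rightarrow> (nat \<Rightarrow> real) \<Rightarrow> (real \<times> real \<Rightarrow> real) \<Rightarrow> nat \<Rightarrow> real" where
  "osc_sum N x y \<phi> n = (\<Sum>w\<in>grid_words N n. oscillation \<phi> (word_cell N x y w))"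

text \<open>
  Coordinates are taken with respect to \<^const>\<open>Basis\<close>; for \<^typ>\<open>real \<times> real \<times> real\<close>,
  which serves as three-dimensional Euclidean space, this is the standard basis.
\<close>

definition coordinate_cubes :: "real \<Rightarrow> 'a::euclidean_space set set" where
  "coordinate_cubes \<epsilon> =
     {{p. \<forall>b\<in>Basis. p \<bullet> b \<in> {of_int (k b) * \<epsilon>..(of_int (k b) + 1) * \<epsilon>}} | k :: 'a \<Rightarrow> int. True}"

definition cube_count :: "'a::euclidean_space set \<Rightarrow> real \<Rightarrow> nat" where
  "cube_count E \<epsilon> = card {Q \<in> coordinate_cubes \<epsilon>. Q \<inter> E \<noteq> {}}"

text \<open>
  The box dimensions are used for bounded nonempty sets only. For these the number of cubes
  is finite and positive whenever \<open>\<epsilon> > 0\<close>, so neither \<^const>\<open>card\<close> nor \<^const>\<open>ln\<close> takes a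
  default value.
\<close>

definition upper_box_dim :: "'a::euclidean_space set \<Rightarrow> ereal" where
  "upper_box_dim E = Limsup (at_right 0) (\<lambda>\<epsilon>. ereal (ln (real (cube_count E \<epsilon>)) / ln (1 / \<epsilon>)))"

definition lower_box_dim :: "'a::euclidean_space set \<Rightarrow> ereal" where
  "lower_box_dim E = Liminf (at_right 0) (\<lambda>\<epsilon>. ereal (ln (real (cube_count E \<epsilon>)) / ln (1 / \<epsilon>)))"

definition graph_over :: "(real \<times> real) set \<Rightarrow> (real \<times> real \<Rightarrow> real) \<Rightarrow> (real \<times> real \<times> real) set" where
  "graph_over D \<phi> = {(s, t, \<phi> (s, t)) | s t. (s, t) \<in> D}"

end

theory Submission
  imports Defs "HOL-Real_Asymp.Real_Asymp"
begin

text \<open>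
  Let \<open>h\<close> be the common side length of the domain \<open>D\<close>. The cells of the words of length \<open>n\<close> are
  exactly the \<open>N ^ n * N ^ n\<close> squares of side \<open>h / N ^ n\<close> that tile \<open>D\<close>, one word for each square:
  the reflections in the maps with even index permute the squares but do not change the tiling.
  So \<open>O\<^sub>n(\<phi>, D)\<close> is a sum over the squares of a mesh (\<open>osc_sum_eq_sum_grid_square\<close>).

  Take \<open>\<epsilon>\<close> comparable to \<open>h / N ^ n\<close>. Above one such square \<open>Q\<close>, the graph is a connected piece
  whose horizontal extent is about \<open>\<epsilon>\<close> and whose height is the oscillation of \<open>\<phi>\<close> on \<open>Q\<close>. So
  it meets at most a constant times \<open>O(\<phi>, Q) / \<epsilon> + 1\<close> cubes, because a bounded number of columns of
  cubes reaches \<open>Q\<close>, and by the intermediate value theorem at least a constant times as many,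
  because the graph cannot jump over a layer of cubes. A cube lies above boundedly many squares,
  so summing over the squares loses only a constant factor in either direction. Hence the number
  of cubes that meet the graph agrees, up to constants independent of \<open>n\<close>, with
  \<open>N ^ n * (O\<^sub>n(\<phi>, D) + N ^ n)\<close>; the two halves are
  \<open>card_graph_cubes_le_sum_oscillation\<close> and \<open>sum_oscillation_le_card_graph_cubes\<close>.

  Taking logarithms and dividing by \<open>ln (1 / \<epsilon>)\<close>, which differs from \<open>n * ln N\<close> by a bounded
  amount, the factor \<open>N ^ n\<close> contributes the summand 1 and the constants vanish in the limit
  (\<open>lower_box_dim_ge\<close>, \<open>upper_box_dim_le\<close>).
\<close>

section \<open>Words and squares of the grid\<close>

definition step_interval :: "real \<Rightarrow> real \<Rightarrow> nat \<Rightarrow> real set" where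
  "step_interval c l a = {c + real a * l..c + (real a + 1) * l}"

definition grid_square :: "real \<Rightarrow> real \<Rightarrow> real \<Rightarrow> nat \<times> nat \<Rightarrow> (real \<times> real) set" where
  "grid_square c d l ab = step_interval c l (fst ab) \<times> step_interval d l (snd ab)"

text \<open>
  The position, counted from 0 at the left, of the image of \<open>I\<close> under the composed cell maps among
  the intervals of its level. An even first letter reverses the orientation, hence the subtraction.
\<close>

fun address :: "nat \<Rightarrow> nat list \<Rightarrow> nat" where
  "address N [] = 0"
| "address N (i # u) =
     (i - 1) * N ^ length u + (if odd i then address N u else N ^ length u - 1 - address N u)"

definition iterated_cell_map :: "nat \<Rightarrow> (nat \<Rightarrow> real) \<Rightarrow> nat list \<Rightarrow> real \<Rightarrow> real" where
  "iterated_cell_map N x u = foldr (\<circ>) (map (cell_map N x) u) id"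

lemma address_less:
  "set u \<subseteq> {1..N} \<Longrightarrow> address N u < N ^ length u"
proof (induction u)
  case Nil
  then show ?case by simp
next
  case (Cons i u)
  let ?M = "N ^ length u"
  let ?r = "if odd i then address N u else ?M - 1 - address N u"
  have less: "address N u < ?M" using Cons by simp
  then have "?r < ?M" by auto
  then have "(i - 1) * ?M + ?r < (i - 1) * ?M + ?M" by simp
  also have "\<dots> = i * ?M" using Cons.prems by (cases i) auto
  also have "\<dots> \<le> N * ?M" using Cons.prems by auto
  finally show ?case by simp
qed

text \<open>
  An address is a base-\<open>N\<close> expansion whose lower digits may be complemented: the leading digit is
  recovered by division, it decides whether the remainder was complemented, and the remainder then
  determines the rest of the word.
\<close>

lemma inj_on_address:
  "inj_on (address N) {u. length u = n \<and> set u \<subseteq> {1..N}}"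
proof (induction n)
  case 0
  then show ?case by (auto simp: inj_on_def)
next
  case (Suc n)
  show ?case
  proof (rule inj_onI)
    fix v w
    assume v: "v \<in> {u. length u = Suc n \<and> set u \<subseteq> {1..N}}"
      and w: "w \<in> {u. length u = Suc n \<and> set u \<subseteq> {1..N}}"
      and eq: "address N v = address N w"
    obtain i v' where v': "v = i # v'" using v by (cases v) auto
    obtain j w' where w': "w = j # w'" using w by (cases w) auto
    have len: "length v' = n" "length w' = n" using v w v' w' by auto
    let ?M = "N ^ n"
    define r where "r = (if odd i then address N v' else ?M - 1 - address N v')"
    define s where "s = (if odd j then address N w' else ?M - 1 - address N w')"
    have lv: "address N v' < ?M" and lw: "address N w' < ?M"
      using address_less[of v' N] address_less[of w' N] v w v' w' by auto
    have rs: "r < ?M" "s < ?M" using lv lw by (auto simp: r_def s_def)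
    have eq': "(i - 1) * ?M + r = (j - 1) * ?M + s"
      using eq unfolding v' w' address.simps len r_def s_def .
    have "i - 1 = ((i - 1) * ?M + r) div ?M" using rs(1) by (subst div_mult_self3) (auto simp del: power_eq_0_iff)
    also have "\<dots> = j - 1" unfolding eq' using rs(2) by (subst div_mult_self3) (auto simp del: power_eq_0_iff)
    finally have "i - 1 = j - 1" .
    then have ij: "i = j" using v w v' w' by auto
    then have "r = s" using eq' by simp
    then have "address N v' = address N w'"
      using lv lw ij by (auto simp: r_def s_def split: if_splits)
    then have "v' = w'"
      using Suc.IH v w v' w' by (auto dest: inj_onD)
    then show "v = w" using ij v' w' by simp
  qed
qed

lemma grid_point:
  fixes x :: "nat \<Rightarrow> real"
  assumes "\<And>i. i \<in> {1..N} \<Longrightarrow> x i - x (i - 1) = (x N - x 0) / real N"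
  shows "i \<le> N \<Longrightarrow> x i = x 0 + real i * ((x N - x 0) / real N)"
proof (induction i)
  case (Suc i)
  then have "x (Suc i) = x i + (x N - x 0) / real N" using assms[of "Suc i"] by simp
  then show ?case using Suc by (simp only: of_nat_Suc distrib_right)
qed simp

text \<open>
  One letter shrinks an interval by the factor \<open>1 / N\<close> and moves it into \<open>I\<^sub>i\<close>. The reflection of
  an even letter turns the interval with index \<open>a\<close> into the one with index \<open>M - 1 - a\<close> within
  \<open>I\<^sub>i\<close>, and it exchanges the two end points.
\<close>

lemma image_step_interval_cell_map:
  fixes x :: "nat \<Rightarrow> real"
  assumes spacing: "\<And>i. i \<in> {1..N} \<Longrightarrow> x i - x (i - 1) = (x N - x 0) / real N"
    and h: "x 0 < x N" and i: "i \<in> {1..N}" and a: "a < M"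
  shows "cell_map N x i ` step_interval (x 0) ((x N - x 0) / real M) a
     = step_interval (x 0) ((x N - x 0) / (real N * real M))
         ((i - 1) * M + (if odd i then a else M - 1 - a))"
proof -
  define h where "h = x N - x 0"
  have hpos: "h > 0" and N: "real N > 0" and M: "real M > 0" using h i a by (auto simp: h_def)
  have xi: "x i = x 0 + real i * (h / real N)" and xi': "x (i - 1) = x 0 + (real i - 1) * (h / real N)"
    using grid_point[OF spacing, of i] grid_point[OF spacing, of "i - 1"] i
    by (auto simp: h_def of_nat_diff)
  have step: "x i - x (i - 1) = h / real N" using spacing[OF i] by (simp only: h_def)
  then have step': "x (i - 1) - x i = - (h / real N)" by linarith
  show ?thesis
  proof (cases "odd i")
    case True
    have eq: "cell_map N x i = (\<lambda>t. (1 / real N) * t + (x (i - 1) - x 0 / real N))"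
    proof
      fix t
      have "cell_map N x i t = x (i - 1) + h / real N * ((t - x 0) / h)"
        using True
        by (simp only: cell_map_def affine_interp_def h_def[symmetric] step not_False_eq_True if_True)
      also have "h / real N * ((t - x 0) / h) = t / real N - x 0 / real N"
        using hpos N by (simp add: field_simps)
      finally show "cell_map N x i t = (1 / real N) * t + (x (i - 1) - x 0 / real N)" by simp
    qed
    have r: "real ((i - 1) * M + a) = (real i - 1) * real M + real a" using i by (simp add: of_nat_diff)
    have le: "x 0 + real a * (h / real M) \<le> x 0 + (real a + 1) * (h / real M)"
      using hpos M by (simp add: divide_right_mono mult_right_mono)
    have "cell_map N x i ` step_interval (x 0) (h / real M) a
      = {(1 / real N) * (x 0 + real a * (h / real M)) + (x (i - 1) - x 0 / real N)
         ..(1 / real N) * (x 0 + (real a + 1) * (h / real M)) + (x (i - 1) - x 0 / real N)}"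
      unfolding step_interval_def eq image_affinity_atLeastAtMost using le N by auto
    also have "\<dots> = step_interval (x 0) (h / (real N * real M)) ((i - 1) * M + a)"
      unfolding step_interval_def r xi' using N M by (simp add: field_simps)
    finally show ?thesis using True by (simp add: h_def)
  next
    case False
    have eq: "cell_map N x i = (\<lambda>t. (- 1 / real N) * t + (x i + x 0 / real N))"
    proof
      fix t
      have "cell_map N x i t = x i + - (h / real N) * ((t - x 0) / h)"
        using False by (simp only: cell_map_def affine_interp_def h_def[symmetric] step' if_False)
      also have "- (h / real N) * ((t - x 0) / h) = x 0 / real N - t / real N"
        using hpos N by (simp add: field_simps)
      finally show "cell_map N x i t = (- 1 / real N) * t + (x i + x 0 / real N)" by simp
    qed
    have "(i - 1) * M + (M - 1 - a) + a + 1 = i * M" using i a by (cases i) auto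
    then have "real ((i - 1) * M + (M - 1 - a)) + real a + 1 = real i * real M"
      by (metis of_nat_add of_nat_1 of_nat_mult)
    then have r: "real ((i - 1) * M + (M - 1 - a)) = real i * real M - 1 - real a" by linarith
    have le: "x 0 + real a * (h / real M) \<le> x 0 + (real a + 1) * (h / real M)"
      using hpos M by (simp add: divide_right_mono mult_right_mono)
    have "cell_map N x i ` step_interval (x 0) (h / real M) a
      = {(- 1 / real N) * (x 0 + (real a + 1) * (h / real M)) + (x i + x 0 / real N)
         ..(- 1 / real N) * (x 0 + real a * (h / real M)) + (x i + x 0 / real N)}"
      unfolding step_interval_def eq image_affinity_atLeastAtMost using le N by auto
    also have "\<dots> = step_interval (x 0) (h / (real N * real M)) ((i - 1) * M + (M - 1 - a))"
      unfolding step_interval_def r xi using N M by (simp add: field_simps)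
    finally show ?thesis using False by (simp add: h_def)
  qed
qed

lemma image_iterated_cell_map:
  fixes x :: "nat \<Rightarrow> real"
  assumes spacing: "\<And>i. i \<in> {1..N} \<Longrightarrow> x i - x (i - 1) = (x N - x 0) / real N"
    and h: "x 0 < x N"
  shows "set u \<subseteq> {1..N} \<Longrightarrow> iterated_cell_map N x u ` {x 0..x N}
     = step_interval (x 0) ((x N - x 0) / real N ^ length u) (address N u)"
proof (induction u)
  case Nil
  then show ?case by (simp add: iterated_cell_map_def step_interval_def)
next
  case (Cons i u)
  have "iterated_cell_map N x (i # u) ` {x 0..x N} = cell_map N x i ` (iterated_cell_map N x u ` {x 0..x N})"
    by (simp add: iterated_cell_map_def image_comp)
  also have "\<dots> = cell_map N x i ` step_interval (x 0) ((x N - x 0) / real (N ^ length u)) (address N u)"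
    using Cons by simp
  also have "\<dots> = step_interval (x 0) ((x N - x 0) / real N ^ length (i # u)) (address N (i # u))"
    using Cons.prems by (subst image_step_interval_cell_map[OF spacing h]) (auto simp: address_less)
  finally show ?case .
qed

lemma word_map_componentwise:
  "word_map N x y w = map_prod (iterated_cell_map N x (map fst w)) (iterated_cell_map N y (map snd w))"
  by (induction w) (auto simp: word_map_def iterated_cell_map_def letter_map_def)

definition word_address :: "nat \<Rightarrow> (nat \<times> nat) list \<Rightarrow> nat \<times> nat" where
  "word_address N w = (address N (map fst w), address N (map snd w))"

lemma word_cell_eq_grid_square:
  assumes "\<And>i. i \<in> {1..N} \<Longrightarrow> x i - x (i - 1) = (x N - x 0) / real N"
    and "\<And>i. i \<in> {1..N} \<Longrightarrow> y i - y (i - 1) = (y N - y 0) / real N"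
    and "x 0 < x N" and "y N - y 0 = x N - x 0"
    and "w \<in> grid_words N n"
  shows "word_cell N x y w = grid_square (x 0) (y 0) ((x N - x 0) / real N ^ n) (word_address N w)"
proof -
  have s: "set (map fst w) \<subseteq> {1..N}" "set (map snd w) \<subseteq> {1..N}" and n: "length w = n"
    using assms(5) by (auto simp: grid_words_def grid_alphabet_def)
  show ?thesis
    using image_iterated_cell_map[OF assms(1) assms(3) s(1)]
      image_iterated_cell_map[OF assms(2) _ s(2)] assms(3,4) n
    by (simp add: word_cell_def grid_dom_def word_map_componentwise map_prod_surj_on
        grid_square_def word_address_def map_prod_image)
qed

text \<open>
  Surjectivity comes for free by counting: there are as many words as squares.
\<close>

lemma bij_betw_word_address:
  "bij_betw (word_address N) (grid_words N n) ({..<N ^ n} \<times> {..<N ^ n})"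
proof -
  have inj: "inj_on (word_address N) (grid_words N n)"
  proof (rule inj_onI)
    fix v w
    assume vw: "v \<in> grid_words N n" "w \<in> grid_words N n" "word_address N v = word_address N w"
    let ?W = "{u. length u = n \<and> set u \<subseteq> {1..N}}"
    have "map fst v \<in> ?W" "map fst w \<in> ?W" "map snd v \<in> ?W" "map snd w \<in> ?W"
      using vw by (auto simp: grid_words_def grid_alphabet_def)
    moreover have "address N (map fst v) = address N (map fst w)"
      "address N (map snd v) = address N (map snd w)"
      using vw(3) by (simp_all add: word_address_def)
    ultimately have "map fst v = map fst w" "map snd v = map snd w"
      using inj_onD[OF inj_on_address[of N n]] by blast+
    then show "v = w" by (metis zip_map_fst_snd)
  qed
  have into: "word_address N ` grid_words N n \<subseteq> {..<N ^ n} \<times> {..<N ^ n}"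
  proof (rule image_subsetI)
    fix w assume w: "w \<in> grid_words N n"
    have "set (map fst w) \<subseteq> {1..N}" "set (map snd w) \<subseteq> {1..N}" "length w = n"
      using w by (auto simp: grid_words_def grid_alphabet_def)
    then show "word_address N w \<in> {..<N ^ n} \<times> {..<N ^ n}"
      using address_less[of "map fst w" N] address_less[of "map snd w" N]
      by (simp add: word_address_def)
  qed
  have "grid_words N n = {w. set w \<subseteq> grid_alphabet N \<and> length w = n}"
    by (auto simp: grid_words_def)
  then have "card (grid_words N n) = (N * N) ^ n"
    by (simp add: card_lists_length_eq grid_alphabet_def)
  then have "card (word_address N ` grid_words N n) = card ({..<N ^ n} \<times> {..<N ^ n})"
    by (simp add: card_image[OF inj] card_cartesian_product power_mult_distrib)
  then have "word_address N ` grid_words N n = {..<N ^ n} \<times> {..<N ^ n}"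
    using into by (intro card_subset_eq) auto
  then show ?thesis using inj by (simp add: bij_betw_def)
qed

lemma osc_sum_eq_sum_grid_square:
  assumes "\<And>i. i \<in> {1..N} \<Longrightarrow> x i - x (i - 1) = (x N - x 0) / real N"
    and "\<And>i. i \<in> {1..N} \<Longrightarrow> y i - y (i - 1) = (y N - y 0) / real N"
    and "x 0 < x N" and "y N - y 0 = x N - x 0"
  shows "osc_sum N x y \<phi> n = (\<Sum>ab\<in>{..<N ^ n} \<times> {..<N ^ n}.
    oscillation \<phi> (grid_square (x 0) (y 0) ((x N - x 0) / real N ^ n) ab))"
proof -
  let ?Q = "grid_square (x 0) (y 0) ((x N - x 0) / real N ^ n)"
  have "osc_sum N x y \<phi> n = (\<Sum>w\<in>grid_words N n. oscillation \<phi> (?Q (word_address N w)))"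
    unfolding osc_sum_def by (intro sum.cong refl) (simp only: word_cell_eq_grid_square[OF assms])
  also have "\<dots> = (\<Sum>ab\<in>{..<N ^ n} \<times> {..<N ^ n}. oscillation \<phi> (?Q ab))"
    by (rule sum.reindex_bij_betw[OF bij_betw_word_address])
  finally show ?thesis .
qed

lemma grid_square_topology:
  assumes "l > 0"
  shows "compact (grid_square c d l ab)" "grid_square c d l ab \<noteq> {}" "connected (grid_square c d l ab)"
proof -
  have "u + real a * l \<le> u + (real a + 1) * l" for u a using assms by simp
  then show "compact (grid_square c d l ab)" "grid_square c d l ab \<noteq> {}" "connected (grid_square c d l ab)"
    by (auto simp: grid_square_def step_interval_def intro!: compact_Times connected_Times)
qed

lemma Union_step_interval:
  assumes "M > 0" and "l > 0"
  shows "(\<Union>a<M. step_interval c l a) = {c..c + real M * l}"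
proof (intro equalityI subsetI)
  fix s assume "s \<in> (\<Union>a<M. step_interval c l a)"
  then obtain a where a: "a < M" "c + real a * l \<le> s" "s \<le> c + (real a + 1) * l"
    by (auto simp: step_interval_def)
  have "(real a + 1) * l \<le> real M * l" using a assms by (intro mult_right_mono) auto
  moreover have "0 \<le> real a * l" using assms by simp
  ultimately show "s \<in> {c..c + real M * l}" using a by (simp del: of_nat_Suc)
next
  fix s assume s: "s \<in> {c..c + real M * l}"
  show "s \<in> (\<Union>a<M. step_interval c l a)"
  proof (cases "s = c + real M * l")
    \<comment> \<open>The right end point belongs to the last interval only; rounding down would give \<open>M\<close>.\<close>
    case True
    then have "s \<in> step_interval c l (M - 1)" using assms
      by (auto simp: step_interval_def of_nat_diff algebra_simps)
    then show ?thesis using assms by auto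
  next
    case False
    define a where "a = nat \<lfloor>(s - c) / l\<rfloor>"
    have nonneg: "0 \<le> (s - c) / l" using s assms by simp
    then have ra: "real a = of_int \<lfloor>(s - c) / l\<rfloor>" by (simp add: a_def)
    have b: "real a \<le> (s - c) / l" "(s - c) / l < real a + 1" unfolding ra by linarith+
    have "(s - c) / l < real M" using False s assms by (simp add: field_simps)
    then have "a < M" using b(1) by simp
    moreover have "s \<in> step_interval c l a" using b assms by (simp add: step_interval_def field_simps)
    ultimately show ?thesis by auto
  qed
qed

lemma Union_grid_square:
  assumes "M > 0" and "l > 0"
  shows "(\<Union>ab\<in>{..<M} \<times> {..<M}. grid_square c d l ab) = {c..c + real M * l} \<times> {d..d + real M * l}"
  unfolding Union_step_interval[OF assms, symmetric] grid_square_def by auto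

section \<open>Counting coordinate cubes that meet a graph\<close>

definition mesh_interval :: "real \<Rightarrow> int \<Rightarrow> real set" where
  "mesh_interval \<epsilon> k = {of_int k * \<epsilon>..(of_int k + 1) * \<epsilon>}"

text \<open>
  The cubes of the mesh are represented by their integer corners, so that the counting below takes
  place in \<^typ>\<open>int \<times> int \<times> int\<close>; \<open>cube_count_graph_over\<close> below justifies this.
\<close>

definition graph_cubes :: "real \<Rightarrow> (real \<times> real) set \<Rightarrow> (real \<times> real \<Rightarrow> real) \<Rightarrow> (int \<times> int \<times> int) set" where
  "graph_cubes \<epsilon> E \<phi> = {(i, j, k). \<exists>p\<in>E.
     fst p \<in> mesh_interval \<epsilon> i \<and> snd p \<in> mesh_interval \<epsilon> j \<and> \<phi> p \<in> mesh_interval \<epsilon> k}"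

lemma mesh_interval_inject:
  assumes "\<epsilon> > 0" "mesh_interval \<epsilon> i = mesh_interval \<epsilon> j"
  shows "i = j"
proof -
  have "of_int i * \<epsilon> = of_int j * \<epsilon>"
    using assms by (auto simp: mesh_interval_def Icc_eq_Icc)
  then show ?thesis using assms by simp
qed

lemma Basis_real3: "(Basis :: (real \<times> real \<times> real) set) = {(1, 0, 0), (0, 1, 0), (0, 0, 1)}"
  by (auto simp: Basis_prod_def zero_prod_def)

lemma coordinate_cubes_3:
  "coordinate_cubes \<epsilon> = (\<lambda>(i, j, k). mesh_interval \<epsilon> i \<times> mesh_interval \<epsilon> j \<times> mesh_interval \<epsilon> k) ` UNIV"
  (is "_ = ?box ` UNIV")
proof (intro equalityI subsetI)
  fix Q :: "(real \<times> real \<times> real) set" assume "Q \<in> coordinate_cubes \<epsilon>"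
  then obtain k :: "real \<times> real \<times> real \<Rightarrow> int"
    where "Q = {p. \<forall>b\<in>Basis. p \<bullet> b \<in> {of_int (k b) * \<epsilon>..(of_int (k b) + 1) * \<epsilon>}}"
    by (auto simp: coordinate_cubes_def)
  then have "Q = ?box (k (1, 0, 0), k (0, 1, 0), k (0, 0, 1))"
    by (auto simp: Basis_real3 mesh_interval_def)
  then show "Q \<in> range ?box" by blast
next
  fix Q assume "Q \<in> range ?box"
  then obtain i j k where Q: "Q = ?box (i, j, k)" by auto
  define m where "m = (\<lambda>b :: real \<times> real \<times> real. if b = (1, 0, 0) then i else if b = (0, 1, 0) then j else k)"
  have "Q = {p. \<forall>b\<in>Basis. p \<bullet> b \<in> {of_int (m b) * \<epsilon>..(of_int (m b) + 1) * \<epsilon>}}"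
    unfolding Q by (auto simp: Basis_real3 mesh_interval_def m_def)
  then show "Q \<in> coordinate_cubes \<epsilon>" unfolding coordinate_cubes_def by blast
qed

lemma cube_count_graph_over:
  assumes "\<epsilon> > 0"
  shows "cube_count (graph_over E \<phi>) \<epsilon> = card (graph_cubes \<epsilon> E \<phi>)"
proof -
  let ?box = "\<lambda>(i, j, k). mesh_interval \<epsilon> i \<times> mesh_interval \<epsilon> j \<times> mesh_interval \<epsilon> k"
  have ne: "mesh_interval \<epsilon> i \<noteq> {}" for i using assms by (auto simp: mesh_interval_def)
  have inj: "inj ?box"
    by (rule injI) (auto simp: times_eq_iff ne dest: mesh_interval_inject[OF assms])
  have meet: "?box g \<inter> graph_over E \<phi> \<noteq> {} \<longleftrightarrow> g \<in> graph_cubes \<epsilon> E \<phi>" for g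
  proof -
    obtain i j k where g: "g = (i, j, k)" by (cases g) auto
    show ?thesis unfolding g graph_cubes_def graph_over_def by auto force
  qed
  have "{Q \<in> coordinate_cubes \<epsilon>. Q \<inter> graph_over E \<phi> \<noteq> {}} = ?box ` graph_cubes \<epsilon> E \<phi>"
    unfolding coordinate_cubes_3 using meet by blast
  then show ?thesis
    unfolding cube_count_def by (simp add: card_image[OF inj_on_subset[OF inj subset_UNIV]])
qed

text \<open>
  The 2 accounts for the closed mesh intervals that only touch or overlap an end point of the
  given interval.
\<close>

lemma card_mesh_intervals_meeting:
  assumes "\<epsilon> > 0" and "a \<le> b"
  shows "finite {k. mesh_interval \<epsilon> k \<inter> {a..b} \<noteq> {}}"
    and "real (card {k. mesh_interval \<epsilon> k \<inter> {a..b} \<noteq> {}}) \<le> (b - a) / \<epsilon> + 2"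
proof -
  have sub: "{k. mesh_interval \<epsilon> k \<inter> {a..b} \<noteq> {}} \<subseteq> {\<lceil>a / \<epsilon>\<rceil> - 1..\<lfloor>b / \<epsilon>\<rfloor>}"
  proof
    fix k assume "k \<in> {k. mesh_interval \<epsilon> k \<inter> {a..b} \<noteq> {}}"
    then obtain t where "of_int k * \<epsilon> \<le> t" "t \<le> (of_int k + 1) * \<epsilon>" "a \<le> t" "t \<le> b"
      unfolding mesh_interval_def by fastforce
    then have "of_int k * \<epsilon> \<le> b" "a \<le> (of_int k + 1) * \<epsilon>" by linarith+
    then have "of_int k \<le> b / \<epsilon>" "a / \<epsilon> \<le> of_int (k + 1)" using assms by (simp_all add: field_simps)
    then show "k \<in> {\<lceil>a / \<epsilon>\<rceil> - 1..\<lfloor>b / \<epsilon>\<rfloor>}" by (simp add: le_floor_iff, linarith)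
  qed
  then show "finite {k. mesh_interval \<epsilon> k \<inter> {a..b} \<noteq> {}}" by (rule finite_subset) simp
  have "card {k. mesh_interval \<epsilon> k \<inter> {a..b} \<noteq> {}} \<le> nat (\<lfloor>b / \<epsilon>\<rfloor> - (\<lceil>a / \<epsilon>\<rceil> - 1) + 1)"
    using card_mono[OF _ sub] by simp
  also have "real \<dots> \<le> (b - a) / \<epsilon> + 2"
  proof -
    have "a / \<epsilon> \<le> b / \<epsilon>" using assms by (simp add: divide_right_mono)
    moreover have "(b - a) / \<epsilon> = b / \<epsilon> - a / \<epsilon>" by (simp add: diff_divide_distrib)
    ultimately show ?thesis by linarith
  qed
  finally show "real (card {k. mesh_interval \<epsilon> k \<inter> {a..b} \<noteq> {}}) \<le> (b - a) / \<epsilon> + 2" by simp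
qed

text \<open>
  The tiling, shifted to start at the origin, is itself a mesh with spacing \<open>l\<close>. So the previous
  bound applies with the two meshes exchanged, and it gives at most \<open>\<epsilon> / l + 2\<close>, which is at
  most 3.
\<close>

lemma card_step_intervals_meeting:
  assumes "0 < \<epsilon>" and "\<epsilon> \<le> l"
  shows "finite {a. step_interval c l a \<inter> mesh_interval \<epsilon> i \<noteq> {}}"
    and "card {a. step_interval c l a \<inter> mesh_interval \<epsilon> i \<noteq> {}} \<le> 3"
proof -
  let ?A = "{a. step_interval c l a \<inter> mesh_interval \<epsilon> i \<noteq> {}}"
  let ?s = "of_int i * \<epsilon> - c"
  let ?K = "{k. mesh_interval l k \<inter> {?s..?s + \<epsilon>} \<noteq> {}}"
  have l: "l > 0" using assms by simp
  have sub: "int ` ?A \<subseteq> ?K"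
  proof clarsimp
    fix a assume "step_interval c l a \<inter> mesh_interval \<epsilon> i \<noteq> {}"
    then obtain t where "t \<in> step_interval c l a" "t \<in> mesh_interval \<epsilon> i" by blast
    then have "t - c \<in> mesh_interval l (int a) \<inter> {?s..?s + \<epsilon>}"
      by (auto simp: step_interval_def mesh_interval_def algebra_simps)
    then show "mesh_interval l (int a) \<inter> {?s..?s + \<epsilon>} = {} \<Longrightarrow> False" by blast
  qed
  have fin: "finite ?K" using assms by (intro card_mesh_intervals_meeting l) simp
  then have "finite (int ` ?A)" using sub finite_subset by blast
  then show "finite ?A" by (rule finite_imageD) simp
  have "card ?A = card (int ` ?A)" by (simp add: card_image)
  also have "\<dots> \<le> card ?K" using card_mono[OF fin sub] .
  finally have "real (card ?A) \<le> real (card ?K)" by simp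
  also have "\<dots> \<le> (?s + \<epsilon> - ?s) / l + 2" using assms by (intro card_mesh_intervals_meeting l) simp
  also have "\<dots> \<le> 3" using assms l by simp
  finally show "card ?A \<le> 3" by simp
qed

text \<open>
  The supremum is a maximum, so that below the range of \<open>\<phi>\<close> on a square can be handled as an
  interval between two attained values.
\<close>

lemma oscillation_attained:
  fixes \<phi> :: "'a::topological_space \<Rightarrow> real"
  assumes "compact E" and "E \<noteq> {}" and "continuous_on E \<phi>"
  obtains p q where "p \<in> E" "q \<in> E" "oscillation \<phi> E = \<phi> p - \<phi> q"
    and "\<And>r. r \<in> E \<Longrightarrow> \<phi> q \<le> \<phi> r" and "\<And>r. r \<in> E \<Longrightarrow> \<phi> r \<le> \<phi> p"
proof -
  obtain p where p: "p \<in> E" "\<And>r. r \<in> E \<Longrightarrow> \<phi> r \<le> \<phi> p"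
    using continuous_attains_sup[OF assms] by blast
  obtain q where q: "q \<in> E" "\<And>r. r \<in> E \<Longrightarrow> \<phi> q \<le> \<phi> r"
    using continuous_attains_inf[OF assms] by blast
  have "oscillation \<phi> E = \<phi> p - \<phi> q"
    unfolding oscillation_def
    by (rule cSup_eq_maximum) (use p q in \<open>auto intro: diff_mono\<close>)
  then show thesis using p q that by blast
qed

text \<open>
  The piece of the graph lies in a box whose horizontal sides are at most \<open>\<epsilon>\<close> and whose height is
  the oscillation. Each horizontal side meets at most 3 mesh intervals, which gives the factor 9.
\<close>

lemma card_graph_cubes_grid_square_le:
  assumes cont: "continuous_on (grid_square c d l ab) \<phi>" and "0 < l" and "l \<le> \<epsilon>"
  shows "finite (graph_cubes \<epsilon> (grid_square c d l ab) \<phi>)"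
    and "real (card (graph_cubes \<epsilon> (grid_square c d l ab) \<phi>))
           \<le> 9 * (oscillation \<phi> (grid_square c d l ab) / \<epsilon> + 2)"
proof -
  let ?E = "grid_square c d l ab"
  have e: "\<epsilon> > 0" using assms by simp
  have E: "compact ?E" "?E \<noteq> {}" using grid_square_topology[OF assms(2)] by auto
  obtain p q where pq: "p \<in> ?E" "q \<in> ?E" "oscillation \<phi> ?E = \<phi> p - \<phi> q"
    and q: "\<And>r. r \<in> ?E \<Longrightarrow> \<phi> q \<le> \<phi> r" and p: "\<And>r. r \<in> ?E \<Longrightarrow> \<phi> r \<le> \<phi> p"
    using oscillation_attained[OF E cont] by metis
  define meet where "meet = (\<lambda>a b. {k. mesh_interval \<epsilon> k \<inter> {a..b} \<noteq> {}})"
  define A where "A = meet (c + real (fst ab) * l) (c + (real (fst ab) + 1) * l)"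
  define B where "B = meet (d + real (snd ab) * l) (d + (real (snd ab) + 1) * l)"
  define K where "K = meet (\<phi> q) (\<phi> p)"
  have sub: "graph_cubes \<epsilon> ?E \<phi> \<subseteq> A \<times> B \<times> K"
    unfolding graph_cubes_def A_def B_def K_def meet_def using p q
    by (fastforce simp: grid_square_def step_interval_def)
  have side: "finite (meet (u + real a * l) (u + (real a + 1) * l))
    \<and> real (card (meet (u + real a * l) (u + (real a + 1) * l))) \<le> 3" for u a
  proof -
    have "u + real a * l \<le> u + (real a + 1) * l" using assms by simp
    note * = card_mesh_intervals_meeting[OF e this]
    have "(u + (real a + 1) * l - (u + real a * l)) / \<epsilon> \<le> 1"
      using assms e by (simp add: algebra_simps)
    then show ?thesis using * unfolding meet_def by linarith
  qed
  have A: "finite A" "real (card A) \<le> 3" and B: "finite B" "real (card B) \<le> 3"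
    using side by (auto simp: A_def B_def)
  have K: "finite K" "real (card K) \<le> oscillation \<phi> ?E / \<epsilon> + 2"
    using card_mesh_intervals_meeting[OF e p[OF pq(2)]] by (auto simp: K_def meet_def pq(3))
  show "finite (graph_cubes \<epsilon> ?E \<phi>)" using finite_subset[OF sub] A B K by simp
  have "card (graph_cubes \<epsilon> ?E \<phi>) \<le> card (A \<times> B \<times> K)" using A B K by (intro card_mono sub) auto
  then have "real (card (graph_cubes \<epsilon> ?E \<phi>)) \<le> real (card A) * (real (card B) * real (card K))"
    by (simp add: card_cartesian_product flip: of_nat_mult)
  also have "\<dots> \<le> 3 * (3 * (oscillation \<phi> ?E / \<epsilon> + 2))"
    using A B K by (intro mult_mono) auto
  finally show "real (card (graph_cubes \<epsilon> ?E \<phi>)) \<le> 9 * (oscillation \<phi> ?E / \<epsilon> + 2)" by simp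
qed

text \<open>
  Only the heights of the cubes are counted. By the intermediate value theorem every layer
  between the minimum and the maximum of \<open>\<phi>\<close> contains a point of the graph, so there are at least
  \<open>max 1 (O(\<phi>, E) / \<epsilon>)\<close> cubes; a maximum of two numbers is at least their mean.
\<close>

lemma card_graph_cubes_ge:
  assumes E: "compact E" "E \<noteq> {}" "connected E" and cont: "continuous_on E \<phi>"
    and e: "\<epsilon> > 0" and fin: "finite (graph_cubes \<epsilon> E \<phi>)"
  shows "(oscillation \<phi> E / \<epsilon> + 1) / 2 \<le> real (card (graph_cubes \<epsilon> E \<phi>))"
proof -
  obtain p q where pq: "p \<in> E" "q \<in> E" "oscillation \<phi> E = \<phi> p - \<phi> q"
    and q: "\<And>r. r \<in> E \<Longrightarrow> \<phi> q \<le> \<phi> r" and p: "\<And>r. r \<in> E \<Longrightarrow> \<phi> r \<le> \<phi> p"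
    using oscillation_attained[OF E(1,2) cont] by metis
  let ?K = "{\<lfloor>\<phi> q / \<epsilon>\<rfloor>..\<lfloor>\<phi> p / \<epsilon>\<rfloor>}"
  have floor_mesh: "t \<in> mesh_interval \<epsilon> \<lfloor>t / \<epsilon>\<rfloor>" for t
  proof -
    have "of_int \<lfloor>t / \<epsilon>\<rfloor> \<le> t / \<epsilon>" "t / \<epsilon> \<le> of_int \<lfloor>t / \<epsilon>\<rfloor> + 1" by linarith+
    then have "of_int \<lfloor>t / \<epsilon>\<rfloor> * \<epsilon> \<le> t" "t \<le> (of_int \<lfloor>t / \<epsilon>\<rfloor> + 1) * \<epsilon>"
      using e by (simp_all only: pos_le_divide_eq pos_divide_le_eq)
    then show ?thesis by (simp add: mesh_interval_def)
  qed
  have sub: "?K \<subseteq> (snd \<circ> snd) ` graph_cubes \<epsilon> E \<phi>"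
  proof
    fix k assume k: "k \<in> ?K"
    \<comment> \<open>a height in layer \<open>k\<close> that lies between the two extremal values of \<open>\<phi>\<close>\<close>
    define t where "t = max (of_int k * \<epsilon>) (\<phi> q)"
    have "of_int k \<le> \<phi> p / \<epsilon>" using k by (simp add: le_floor_iff)
    then have kp: "of_int k * \<epsilon> \<le> \<phi> p" using e by (simp add: field_simps)
    have "\<phi> q / \<epsilon> \<le> of_int k + 1" using k by (auto, linarith)
    then have kq: "\<phi> q \<le> (of_int k + 1) * \<epsilon>" using e by (simp add: field_simps)
    have t: "t \<in> mesh_interval \<epsilon> k" using kq e by (auto simp: t_def mesh_interval_def)
    have "\<phi> q \<le> t" "t \<le> \<phi> p" using kp p[OF pq(2)] by (auto simp: t_def)
    then have "t \<in> \<phi> ` E"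
      using connectedD_interval[OF connected_continuous_image[OF cont E(3)], of "\<phi> q" "\<phi> p" t] pq by auto
    then obtain r where r: "r \<in> E" "\<phi> r = t" by auto
    then have "(\<lfloor>fst r / \<epsilon>\<rfloor>, \<lfloor>snd r / \<epsilon>\<rfloor>, k) \<in> graph_cubes \<epsilon> E \<phi>"
      using t floor_mesh by (auto simp: graph_cubes_def)
    then show "k \<in> (snd \<circ> snd) ` graph_cubes \<epsilon> E \<phi>" by force
  qed
  have "card ?K \<le> card ((snd \<circ> snd) ` graph_cubes \<epsilon> E \<phi>)"
    by (rule card_mono[OF _ sub]) (simp add: fin)
  also have "\<dots> \<le> card (graph_cubes \<epsilon> E \<phi>)" by (rule card_image_le[OF fin])
  finally have "real (card ?K) \<le> real (card (graph_cubes \<epsilon> E \<phi>))" by simp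
  moreover have "oscillation \<phi> E / \<epsilon> \<le> real (card ?K)" "1 \<le> real (card ?K)"
  proof -
    have le: "\<phi> q / \<epsilon> \<le> \<phi> p / \<epsilon>" using p[OF pq(2)] e by (simp add: divide_right_mono)
    have eq: "real (card ?K) = of_int (\<lfloor>\<phi> p / \<epsilon>\<rfloor> - \<lfloor>\<phi> q / \<epsilon>\<rfloor> + 1)"
      using floor_mono[OF le] by simp
    show "1 \<le> real (card ?K)" unfolding eq using floor_mono[OF le] by simp
    have "oscillation \<phi> E / \<epsilon> = \<phi> p / \<epsilon> - \<phi> q / \<epsilon>" by (simp add: pq(3) diff_divide_distrib)
    then show "oscillation \<phi> E / \<epsilon> \<le> real (card ?K)" unfolding eq by linarith
  qed
  ultimately show ?thesis by (simp add: field_simps)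
qed

lemma graph_cubes_Union:
  "graph_cubes \<epsilon> (\<Union>i\<in>A. E i) \<phi> = (\<Union>i\<in>A. graph_cubes \<epsilon> (E i) \<phi>)"
  by (auto simp: graph_cubes_def)

lemma card_graph_cubes_le_sum_oscillation:
  fixes M :: nat
  assumes cont: "continuous_on ({c..c + real M * l} \<times> {d..d + real M * l}) \<phi>"
    and M: "M > 0" and l: "0 < l" "l \<le> \<epsilon>"
    and S: "S = (\<Sum>ab\<in>{..<M} \<times> {..<M}. oscillation \<phi> (grid_square c d l ab))"
  shows "finite (graph_cubes \<epsilon> ({c..c + real M * l} \<times> {d..d + real M * l}) \<phi>)"
    and "real (card (graph_cubes \<epsilon> ({c..c + real M * l} \<times> {d..d + real M * l}) \<phi>))
           \<le> 9 * (S / \<epsilon> + 2 * real M ^ 2)"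
proof -
  let ?I = "{..<M} \<times> {..<M}" and ?D = "{c..c + real M * l} \<times> {d..d + real M * l}"
  let ?C = "\<lambda>ab. graph_cubes \<epsilon> (grid_square c d l ab) \<phi>"
  have D: "?D = (\<Union>ab\<in>?I. grid_square c d l ab)" using Union_grid_square[OF M l(1)] by simp
  have U: "graph_cubes \<epsilon> ?D \<phi> = (\<Union>ab\<in>?I. ?C ab)" by (simp only: D graph_cubes_Union)
  have cell: "continuous_on (grid_square c d l ab) \<phi>" if "ab \<in> ?I" for ab
    by (rule continuous_on_subset[OF cont]) (use that in \<open>unfold D, blast\<close>)
  note bound = card_graph_cubes_grid_square_le[OF cell l]
  show "finite (graph_cubes \<epsilon> ?D \<phi>)" unfolding U using bound(1) by blast
  have "card (graph_cubes \<epsilon> ?D \<phi>) \<le> (\<Sum>ab\<in>?I. card (?C ab))"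
    unfolding U by (rule card_UN_le) simp
  then have "real (card (graph_cubes \<epsilon> ?D \<phi>)) \<le> (\<Sum>ab\<in>?I. real (card (?C ab)))"
    by (metis of_nat_le_iff of_nat_sum)
  also have "\<dots> \<le> (\<Sum>ab\<in>?I. 9 * (oscillation \<phi> (grid_square c d l ab) / \<epsilon> + 2))"
    by (rule sum_mono) (rule bound(2))
  also have "\<dots> = 9 * (S / \<epsilon> + 2 * real M ^ 2)"
    by (simp add: S sum.distrib power2_eq_square flip: sum_distrib_left sum_divide_distrib)
  finally show "real (card (graph_cubes \<epsilon> ?D \<phi>)) \<le> 9 * (S / \<epsilon> + 2 * real M ^ 2)" .
qed

text \<open>
  Summing the bounds for single squares counts a cube once for each square it lies above. Since
  \<open>\<epsilon> \<le> l\<close>, a cube meets at most 3 columns and 3 rows of the tiling, so at most 9 squares;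
  together with the factor 2 of the bound for a single square this gives 18.
\<close>

lemma sum_oscillation_le_card_graph_cubes:
  fixes M :: nat
  assumes cont: "continuous_on ({c..c + real M * l} \<times> {d..d + real M * l}) \<phi>"
    and M: "M > 0" and e: "0 < \<epsilon>" "\<epsilon> \<le> l"
    and fin: "finite (graph_cubes \<epsilon> ({c..c + real M * l} \<times> {d..d + real M * l}) \<phi>)"
    and S: "S = (\<Sum>ab\<in>{..<M} \<times> {..<M}. oscillation \<phi> (grid_square c d l ab))"
  shows "(S / \<epsilon> + real M ^ 2) / 18
           \<le> real (card (graph_cubes \<epsilon> ({c..c + real M * l} \<times> {d..d + real M * l}) \<phi>))"
proof -
  let ?I = "{..<M} \<times> {..<M}" and ?D = "{c..c + real M * l} \<times> {d..d + real M * l}"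
  let ?C = "\<lambda>ab. graph_cubes \<epsilon> (grid_square c d l ab) \<phi>"
  let ?G = "graph_cubes \<epsilon> ?D \<phi>"
  have l: "l > 0" using e by simp
  have D: "?D = (\<Union>ab\<in>?I. grid_square c d l ab)" using Union_grid_square[OF M l] by simp
  have U: "?G = (\<Union>ab\<in>?I. ?C ab)" by (simp only: D graph_cubes_Union)
  have cell: "continuous_on (grid_square c d l ab) \<phi>" if "ab \<in> ?I" for ab
    by (rule continuous_on_subset[OF cont]) (use that in \<open>unfold D, blast\<close>)
  note sq = grid_square_topology[OF l]
  have lower: "(oscillation \<phi> (grid_square c d l ab) / \<epsilon> + 1) / 2 \<le> real (card (?C ab))" if "ab \<in> ?I" for ab
    by (rule card_graph_cubes_ge[OF sq cell[OF that] e(1)])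
       (rule finite_subset[OF _ fin], use that in \<open>unfold U, blast\<close>)
  have multiplicity: "card {ab \<in> ?I. g \<in> ?C ab} \<le> 9" for g
  proof -
    obtain i j k where g: "g = (i, j, k)" by (cases g) auto
    let ?A = "{a. step_interval c l a \<inter> mesh_interval \<epsilon> i \<noteq> {}}"
    let ?B = "{a. step_interval d l a \<inter> mesh_interval \<epsilon> j \<noteq> {}}"
    have A: "finite ?A" "card ?A \<le> 3" and B: "finite ?B" "card ?B \<le> 3"
      using card_step_intervals_meeting[OF e] by blast+
    have "{ab \<in> ?I. g \<in> ?C ab} \<subseteq> ?A \<times> ?B"
      unfolding g graph_cubes_def grid_square_def by fastforce
    then have "card {ab \<in> ?I. g \<in> ?C ab} \<le> card (?A \<times> ?B)" using A B by (intro card_mono) auto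
    also have "\<dots> \<le> 3 * 3" unfolding card_cartesian_product using A B by (intro mult_mono) auto
    finally show ?thesis by simp
  qed
  have "(S / \<epsilon> + real M ^ 2) / 2 = (\<Sum>ab\<in>?I. (oscillation \<phi> (grid_square c d l ab) / \<epsilon> + 1) / 2)"
    by (simp add: S sum.distrib power2_eq_square flip: sum_divide_distrib)
  also have "\<dots> \<le> (\<Sum>ab\<in>?I. real (card (?C ab)))" by (rule sum_mono) (rule lower)
  also have "\<dots> = real (\<Sum>ab\<in>?I. \<Sum>g | g \<in> ?G \<and> g \<in> ?C ab. 1)"
  proof -
    have "?C ab = {g. g \<in> ?G \<and> g \<in> ?C ab}" if "ab \<in> ?I" for ab unfolding U using that by blast
    then show ?thesis by simp
  qed
  \<comment> \<open>double counting of the pairs of a square and a cube above it\<close>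
  also have "(\<Sum>ab\<in>?I. \<Sum>g | g \<in> ?G \<and> g \<in> ?C ab. 1) = (\<Sum>g\<in>?G. \<Sum>ab | ab \<in> ?I \<and> g \<in> ?C ab. 1)"
    by (rule sum.swap_restrict) (use fin in auto)
  also have "real \<dots> \<le> real (\<Sum>g\<in>?G. 9)"
    by (intro of_nat_mono sum_mono) (use multiplicity in simp)
  finally show ?thesis by simp
qed

section \<open>From counts at comparable scales to dimensions\<close>

text \<open>
  Every small \<open>\<epsilon>\<close> lies between two consecutive scales \<open>h / b ^ n\<close>, and then \<open>n * ln b\<close> replaces
  \<open>ln (1 / \<epsilon>)\<close> with a bounded error.
\<close>

lemma scale_between_powers:
  fixes b h \<epsilon> :: real
  assumes b: "b > 1" and h: "h > 0" and e: "0 < \<epsilon>" "\<epsilon> < h / b ^ m"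
  obtains n where "n \<ge> m" "h / b ^ Suc n < \<epsilon>" "\<epsilon> \<le> h / b ^ n"
    "\<bar>real n * ln b - ln (1 / \<epsilon>)\<bar> \<le> \<bar>ln h\<bar> + ln b"
proof -
  obtain k where "h / \<epsilon> < b ^ k" using real_arch_pow[OF b] by blast
  then have k: "h / b ^ k < \<epsilon>" using e b by (simp add: field_simps)
  define j where "j = (LEAST k. h / b ^ k < \<epsilon>)"
  have j: "h / b ^ j < \<epsilon>" unfolding j_def using k by (rule LeastI)
  have "m < j"
  proof (rule ccontr)
    assume "\<not> m < j"
    then have "h / b ^ m \<le> h / b ^ j" using b h by (intro divide_left_mono power_increasing) auto
    then show False using j e by simp
  qed
  then obtain n where n: "j = Suc n" "n \<ge> m" by (cases j) auto
  have le: "\<epsilon> \<le> h / b ^ n" using not_less_Least[of n "\<lambda>k. h / b ^ k < \<epsilon>"] n by (simp add: j_def not_less)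
  have "ln \<epsilon> \<le> ln (h / b ^ n)" using le e by (simp add: ln_mono)
  then have 1: "ln \<epsilon> \<le> ln h - real n * ln b" using h b by (simp add: ln_div ln_realpow)
  have "ln (h / b ^ Suc n) \<le> ln \<epsilon>" using j n h b e by (intro ln_mono) auto
  then have 2: "ln h - (real n + 1) * ln b \<le> ln \<epsilon>" using h b
    by (subst (asm) ln_div) (auto simp: ln_realpow ln_mult algebra_simps)
  have "0 < ln b" using b by simp
  moreover have "(real n + 1) * ln b = real n * ln b + ln b" by (simp add: algebra_simps)
  moreover have "ln (1 / \<epsilon>) = - ln \<epsilon>" using e by (simp add: ln_div)
  ultimately have "\<bar>real n * ln b - ln (1 / \<epsilon>)\<bar> \<le> \<bar>ln h\<bar> + ln b"
    using 1 2 unfolding abs_le_iff by (smt (verit))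
  then show thesis using that n j le by blast
qed

lemma abs_mult_perturb:
  fixes r s t K :: real
  assumes "\<bar>s - t\<bar> \<le> K"
  shows "r * t - \<bar>r\<bar> * K \<le> r * s" and "r * s \<le> r * t + \<bar>r\<bar> * K"
proof -
  have "\<bar>r * (s - t)\<bar> \<le> \<bar>r\<bar> * K" unfolding abs_mult using assms by (intro mult_left_mono) auto
  moreover have "r * (s - t) = r * s - r * t" by (simp add: algebra_simps)
  ultimately show "r * t - \<bar>r\<bar> * K \<le> r * s" "r * s \<le> r * t + \<bar>r\<bar> * K" by linarith+
qed

text \<open>
  If \<open>r - 1\<close> is below the lower limit, then eventually \<open>S n > (b ^ n) powr (r - 1)\<close>, so the number
  of cubes is at least \<open>c * (b ^ n) powr r\<close>, where \<open>b ^ n\<close> is comparable to \<open>1 / \<epsilon>\<close>. The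
  constants add a term \<open>B / ln (1 / \<epsilon>)\<close>, which tends to 0. Working with real bounds \<open>r\<close>
  instead of the limits also covers infinite values.
\<close>

lemma lower_box_dim_ge:
  fixes b h c :: real and S :: "nat \<Rightarrow> real"
  assumes b: "b > 1" and h: "h > 0" and c: "c > 0" and S: "\<And>n. S n > 0"
    and count: "\<And>n \<epsilon>. 0 < \<epsilon> \<Longrightarrow> \<epsilon> \<le> h / b ^ n \<Longrightarrow> c * b ^ n * S n \<le> real (cube_count E \<epsilon>)"
  shows "1 + liminf (\<lambda>n. ereal (ln (S n) / (real n * ln b))) \<le> lower_box_dim E"
proof (rule dense_le)
  fix z assume z: "z < 1 + liminf (\<lambda>n. ereal (ln (S n) / (real n * ln b)))"
  show "z \<le> lower_box_dim E"
  proof (cases z)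
    case (real r)
    have "ereal (r - 1) < liminf (\<lambda>n. ereal (ln (S n) / (real n * ln b)))"
      using z real by (cases "liminf (\<lambda>n. ereal (ln (S n) / (real n * ln b)))") auto
    from less_LiminfD[OF this] obtain m0 where m0: "\<And>n. n \<ge> m0 \<Longrightarrow> r - 1 < ln (S n) / (real n * ln b)"
      by (auto simp: eventually_sequentially)
    define m where "m = max m0 1"
    define K where "K = \<bar>ln h\<bar> + ln b"
    define B where "B = ln c - \<bar>r\<bar> * K"
    have "eventually (\<lambda>\<epsilon>. 0 < \<epsilon> \<and> \<epsilon> < min 1 (h / b ^ m)) (at_right 0)"
      using h b by (intro eventually_at_rightI[of 0 "min 1 (h / b ^ m)"]) auto
    then have ev: "eventually (\<lambda>\<epsilon>. ereal (r + B / ln (1 / \<epsilon>))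
        \<le> ereal (ln (real (cube_count E \<epsilon>)) / ln (1 / \<epsilon>))) (at_right 0)"
    proof eventually_elim
      case (elim \<epsilon>)
      obtain n where n: "n \<ge> m" "\<epsilon> \<le> h / b ^ n" "\<bar>real n * ln b - ln (1 / \<epsilon>)\<bar> \<le> K"
        using scale_between_powers[OF b h, of \<epsilon> m] elim unfolding K_def by auto
      have L: "ln (1 / \<epsilon>) > 0" using elim by simp
      have "real n * ln b > 0" using n b by (simp add: m_def)
      then have "(r - 1) * (real n * ln b) < ln (S n)"
        using m0[of n] n by (simp add: m_def pos_less_divide_eq)
      then have "B + r * ln (1 / \<epsilon>) \<le> ln c + real n * ln b + ln (S n)"
        using abs_mult_perturb(1)[OF n(3), of r] unfolding B_def left_diff_distrib by linarith
      also have "\<dots> = ln (c * b ^ n * S n)" using c b S[of n] by (simp add: ln_mult ln_realpow)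
      also have "\<dots> \<le> ln (real (cube_count E \<epsilon>))"
        using count[of \<epsilon> n] elim n c b S[of n] by (intro ln_mono) auto
      finally have "B + r * ln (1 / \<epsilon>) \<le> ln (real (cube_count E \<epsilon>))" .
      moreover have "r + B / ln (1 / \<epsilon>) = (B + r * ln (1 / \<epsilon>)) / ln (1 / \<epsilon>)"
        using L by (simp add: add_divide_distrib)
      ultimately show ?case using L by (simp only: ereal_less_eq divide_right_mono less_imp_le)
    qed
    have "((\<lambda>\<epsilon>. r + B / ln (1 / \<epsilon>)) \<longlongrightarrow> r) (at_right 0)" by real_asymp
    then have "Liminf (at_right 0) (\<lambda>\<epsilon>. ereal (r + B / ln (1 / \<epsilon>))) = ereal r"
      by (intro lim_imp_Liminf) auto
    then show ?thesis using Liminf_mono[OF ev] by (simp add: lower_box_dim_def real)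
  qed (use z in auto)
qed

text \<open>
  The mirror image of the previous argument, with the finer of the two scales around \<open>\<epsilon>\<close>; this
  choice costs the second \<open>ln b\<close> in the constant \<open>K\<close>. The positivity of the count excludes the
  default value of \<^const>\<open>ln\<close> at 0.
\<close>

lemma upper_box_dim_le:
  fixes b h c :: real and S :: "nat \<Rightarrow> real"
  assumes b: "b > 1" and h: "h > 0" and c: "c > 0" and S: "\<And>n. S n > 0"
    and pos: "\<And>\<epsilon>. 0 < \<epsilon> \<Longrightarrow> \<epsilon> < h \<Longrightarrow> 0 < cube_count E \<epsilon>"
    and count: "\<And>n \<epsilon>. h / b ^ n \<le> \<epsilon> \<Longrightarrow> real (cube_count E \<epsilon>) \<le> c * b ^ n * S n"
  shows "upper_box_dim E \<le> 1 + limsup (\<lambda>n. ereal (ln (S n) / (real n * ln b)))"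
proof (rule dense_ge)
  fix z assume z: "1 + limsup (\<lambda>n. ereal (ln (S n) / (real n * ln b))) < z"
  show "upper_box_dim E \<le> z"
  proof (cases z)
    case (real r)
    have "limsup (\<lambda>n. ereal (ln (S n) / (real n * ln b))) < ereal (r - 1)"
      using z real by (cases "limsup (\<lambda>n. ereal (ln (S n) / (real n * ln b)))") auto
    from Limsup_lessD[OF this] obtain m where m: "\<And>n. n \<ge> m \<Longrightarrow> ln (S n) / (real n * ln b) < r - 1"
      by (auto simp: eventually_sequentially)
    define K where "K = \<bar>ln h\<bar> + 2 * ln b"
    define B where "B = ln c + \<bar>r\<bar> * K"
    have "eventually (\<lambda>\<epsilon>. 0 < \<epsilon> \<and> \<epsilon> < min 1 (h / b ^ m)) (at_right 0)"
      using h b by (intro eventually_at_rightI[of 0 "min 1 (h / b ^ m)"]) auto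
    then have ev: "eventually (\<lambda>\<epsilon>. ereal (ln (real (cube_count E \<epsilon>)) / ln (1 / \<epsilon>))
        \<le> ereal (r + B / ln (1 / \<epsilon>))) (at_right 0)"
    proof eventually_elim
      case (elim \<epsilon>)
      obtain n' where n': "n' \<ge> m" "h / b ^ Suc n' < \<epsilon>" "\<epsilon> \<le> h / b ^ n'"
          "\<bar>real n' * ln b - ln (1 / \<epsilon>)\<bar> \<le> \<bar>ln h\<bar> + ln b"
        using scale_between_powers[OF b h, of \<epsilon> m] elim by auto
      define n where "n = Suc n'"
      have lnb: "ln b > 0" using b by simp
      have n: "n \<ge> m" "h / b ^ n \<le> \<epsilon>" using n' by (auto simp: n_def)
      have nK: "\<bar>real n * ln b - ln (1 / \<epsilon>)\<bar> \<le> K"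
        using n'(4) lnb unfolding n_def K_def of_nat_Suc distrib_right by linarith
      have L: "ln (1 / \<epsilon>) > 0" using elim by simp
      have "h / b ^ m \<le> h" using b h by (simp add: divide_le_eq)
      then have "cube_count E \<epsilon> > 0" using elim by (intro pos) auto
      then have "ln (real (cube_count E \<epsilon>)) \<le> ln (c * b ^ n * S n)"
        using count[OF n(2)] by (intro ln_mono) auto
      also have "\<dots> = ln c + real n * ln b + ln (S n)" using c b S[of n] by (simp add: ln_mult ln_realpow)
      also have "\<dots> \<le> B + r * ln (1 / \<epsilon>)"
      proof -
        have "real n * ln b > 0" using lnb by (simp add: n_def)
        then have "ln (S n) < (r - 1) * (real n * ln b)"
          using m[OF n(1)] by (simp add: pos_divide_less_eq)
        then show ?thesis
          using abs_mult_perturb(2)[OF nK, of r] unfolding B_def left_diff_distrib by linarith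
      qed
      finally have "ln (real (cube_count E \<epsilon>)) \<le> B + r * ln (1 / \<epsilon>)" .
      moreover have "r + B / ln (1 / \<epsilon>) = (B + r * ln (1 / \<epsilon>)) / ln (1 / \<epsilon>)"
        using L by (simp add: add_divide_distrib)
      ultimately show ?case using L by (simp only: ereal_less_eq divide_right_mono less_imp_le)
    qed
    have "((\<lambda>\<epsilon>. r + B / ln (1 / \<epsilon>)) \<longlongrightarrow> r) (at_right 0)" by real_asymp
    then have "Limsup (at_right 0) (\<lambda>\<epsilon>. ereal (r + B / ln (1 / \<epsilon>))) = ereal r"
      by (intro lim_imp_Limsup) auto
    then show ?thesis using Limsup_mono[OF ev] by (simp add: upper_box_dim_def real)
  qed (use z in auto)
qed

section \<open>Box dimensions of the graph\<close>

theorem lemma2p3: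
  fixes N :: nat and x y :: "nat \<Rightarrow> real" and \<phi> :: "real \<times> real \<Rightarrow> real"
  assumes "N \<ge> 2"
    and "strict_mono_on {0..N} x"
    and "strict_mono_on {0..N} y"
    and "\<And>i. i \<in> {1..N} \<Longrightarrow> x i - x (i - 1) = (x N - x 0) / real N"
    and "\<And>i. i \<in> {1..N} \<Longrightarrow> y i - y (i - 1) = (y N - y 0) / real N"
    and "x N - x 0 = y N - y 0"
    and "continuous_on (grid_dom N x y) \<phi>"
  shows "1 + liminf (\<lambda>n. ereal (ln (osc_sum N x y \<phi> n + real N ^ n) / (real n * ln (real N))))
           \<le> lower_box_dim (graph_over (grid_dom N x y) \<phi>)
       \<and> lower_box_dim (graph_over (grid_dom N x y) \<phi>)
           \<le> upper_box_dim (graph_over (grid_dom N x y) \<phi>)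
       \<and> upper_box_dim (graph_over (grid_dom N x y) \<phi>)
           \<le> 1 + limsup (\<lambda>n. ereal (ln (osc_sum N x y \<phi> n + real N ^ n) / (real n * ln (real N))))"
proof -
  define h where "h = x N - x 0"
  define S where "S = (\<lambda>n. osc_sum N x y \<phi> n + real N ^ n)"
  let ?D = "grid_dom N x y"
  let ?l = "\<lambda>n. h / real N ^ n"
  have xN: "x 0 < x N" using assms(1,2) by (auto simp: strict_mono_on_def)
  then have h: "h > 0" by (simp add: h_def)
  have N: "real N > 1" using assms(1) by simp
  have Npos: "real N ^ n > 0" for n using N by simp
  have D: "?D = {x 0..x 0 + real (N ^ n) * ?l n} \<times> {y 0..y 0 + real (N ^ n) * ?l n}" for n
  proof -
    have "x N = x 0 + h" "y N = y 0 + h" using assms(6) by (simp_all add: h_def)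
    then show ?thesis using N by (simp add: grid_dom_def)
  qed
  have osc: "osc_sum N x y \<phi> n =
      (\<Sum>ab\<in>{..<N ^ n} \<times> {..<N ^ n}. oscillation \<phi> (grid_square (x 0) (y 0) (?l n) ab))" for n
    unfolding h_def
    by (rule osc_sum_eq_sum_grid_square[OF assms(4,5) xN assms(6)[symmetric]])
  have osc_nonneg: "osc_sum N x y \<phi> n \<ge> 0" for n
    unfolding osc
  proof (rule sum_nonneg)
    fix ab assume ab: "ab \<in> {..<N ^ n} \<times> {..<N ^ n}"
    let ?Q = "grid_square (x 0) (y 0) (?l n) ab"
    have l: "?l n > 0" using h Npos by simp
    have "?Q \<subseteq> ?D"
      unfolding D[of n] using Union_grid_square[OF _ l, of "N ^ n" "x 0" "y 0"] ab N by auto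
    then have "continuous_on ?Q \<phi>" using assms(7) continuous_on_subset by blast
    moreover have "compact ?Q" "?Q \<noteq> {}" using grid_square_topology[OF l] by auto
    ultimately obtain p q where "p \<in> ?Q" "oscillation \<phi> ?Q = \<phi> p - \<phi> q" "\<And>r. r \<in> ?Q \<Longrightarrow> \<phi> q \<le> \<phi> r"
      using oscillation_attained by metis
    then show "oscillation \<phi> ?Q \<ge> 0" by simp
  qed
  then have S: "S n > 0" for n using Npos[of n] by (simp add: S_def add_nonneg_pos)
  have upper: "real (cube_count (graph_over ?D \<phi>) \<epsilon>) \<le> (9 / h + 18) * real N ^ n * S n
      \<and> finite (graph_cubes \<epsilon> ?D \<phi>)" if e: "?l n \<le> \<epsilon>" for n \<epsilon>
  proof -
    have l: "?l n > 0" using h Npos by simp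
    have e0: "\<epsilon> > 0" using e l by simp
    have M: "N ^ n > 0" using N by simp
    note * = card_graph_cubes_le_sum_oscillation[OF assms(7)[unfolded D[of n]] M l e osc, folded D[of n]]
    have "1 / \<epsilon> \<le> real N ^ n / h" using e e0 h Npos[of n] by (simp add: field_simps)
    then have "osc_sum N x y \<phi> n * (1 / \<epsilon>) \<le> osc_sum N x y \<phi> n * (real N ^ n / h)"
      by (intro mult_left_mono osc_nonneg)
    then have "9 * (osc_sum N x y \<phi> n / \<epsilon> + 2 * real (N ^ n) ^ 2)
        \<le> 9 * (osc_sum N x y \<phi> n * (real N ^ n / h) + 2 * real (N ^ n) ^ 2)" by simp
    also have "\<dots> \<le> (9 / h + 18) * real N ^ n * S n"
    proof -
      have "0 \<le> 18 * (real N ^ n * osc_sum N x y \<phi> n)" "0 \<le> 9 / h * (real N ^ n * real N ^ n)"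
        using osc_nonneg[of n] h Npos by auto
      moreover have "(9 / h + 18) * real N ^ n * S n
          = 9 * (osc_sum N x y \<phi> n * (real N ^ n / h) + 2 * real (N ^ n) ^ 2)
            + (18 * (real N ^ n * osc_sum N x y \<phi> n) + 9 / h * (real N ^ n * real N ^ n))"
        using h by (simp add: S_def power2_eq_square field_simps)
      ultimately show ?thesis by linarith
    qed
    finally show ?thesis using * by (simp add: cube_count_graph_over[OF e0])
  qed
  \<comment> \<open>The upper bound at a level finer than \<open>\<epsilon>\<close> already shows that only finitely many cubes meet the
    graph, which the lower bound needs because \<^const>\<open>card\<close> is 0 on infinite sets.\<close>
  have fin: "finite (graph_cubes \<epsilon> ?D \<phi>)" if e: "\<epsilon> > 0" for \<epsilon>
  proof -
    obtain n where "h / \<epsilon> < real N ^ n" using real_arch_pow[OF N] by blast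
    then have "?l n \<le> \<epsilon>" using e Npos[of n] by (simp add: field_simps)
    then show ?thesis using upper by blast
  qed
  have lower: "1 / (18 * (1 + h)) * real N ^ n * S n \<le> real (cube_count (graph_over ?D \<phi>) \<epsilon>)"
    if e: "0 < \<epsilon>" "\<epsilon> \<le> ?l n" for n \<epsilon>
  proof -
    have M: "N ^ n > 0" using N by simp
    \<comment> \<open>\<open>1 / (1 + h)\<close> is a positive number below both 1 and \<open>1 / h\<close>, so it serves both summands of \<open>S n\<close>.\<close>
    have "real N ^ n / (1 + h) \<le> real N ^ n / h" using h by (intro divide_left_mono) auto
    also have "\<dots> \<le> 1 / \<epsilon>" using e h Npos[of n] by (simp add: field_simps)
    finally have "osc_sum N x y \<phi> n * (real N ^ n / (1 + h)) \<le> osc_sum N x y \<phi> n * (1 / \<epsilon>)"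
      by (intro mult_left_mono osc_nonneg)
    moreover have "real N ^ n * real N ^ n / (1 + h) \<le> real N ^ n * real N ^ n"
      using h divide_left_mono[of 1 "1 + h" "real N ^ n * real N ^ n"] by simp
    moreover have "real N ^ n * S n / (1 + h)
        = osc_sum N x y \<phi> n * (real N ^ n / (1 + h)) + real N ^ n * real N ^ n / (1 + h)"
      by (simp add: S_def distrib_left add_divide_distrib mult.commute)
    ultimately have "(real N ^ n * S n / (1 + h)) / 18
        \<le> (osc_sum N x y \<phi> n / \<epsilon> + real (N ^ n) ^ 2) / 18"
      by (intro divide_right_mono) (simp_all add: power2_eq_square)
    also have "\<dots> \<le> real (card (graph_cubes \<epsilon> ?D \<phi>))"
      using sum_oscillation_le_card_graph_cubes[OF assms(7)[unfolded D[of n]] M e fin[OF e(1), unfolded D[of n]] osc,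
          folded D[of n]] .
    finally show ?thesis by (simp add: cube_count_graph_over[OF e(1)] mult.commute)
  qed
  have pos: "0 < cube_count (graph_over ?D \<phi>) \<epsilon>" if "0 < \<epsilon>" "\<epsilon> < h" for \<epsilon>
  proof -
    have "0 < 1 / (18 * (1 + h)) * real N ^ 0 * S 0" using h S[of 0] by simp
    also have "\<dots> \<le> real (cube_count (graph_over ?D \<phi>) \<epsilon>)" using lower[of \<epsilon> 0] that by simp
    finally show ?thesis by simp
  qed
  have "1 + liminf (\<lambda>n. ereal (ln (S n) / (real n * ln (real N)))) \<le> lower_box_dim (graph_over ?D \<phi>)"
    by (rule lower_box_dim_ge[OF N h _ S lower]) (use h in auto)
  moreover have "lower_box_dim (graph_over ?D \<phi>) \<le> upper_box_dim (graph_over ?D \<phi>)"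
    unfolding lower_box_dim_def upper_box_dim_def by (rule Liminf_le_Limsup) simp
  moreover have "upper_box_dim (graph_over ?D \<phi>) \<le> 1 + limsup (\<lambda>n. ereal (ln (S n) / (real n * ln (real N))))"
    by (rule upper_box_dim_le[OF N h _ S pos upper[THEN conjunct1]]) (use h in \<open>auto intro: add_pos_pos\<close>)
  ultimately show ?thesis unfolding S_def by blast
qed

end
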